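(* Let $\mathcal{T}=(t_{ijkl})\in\mathcal{E}_{4,3}$. Call a permutation $(i,j,k)$ of $(1,2,3)$ admissible if $t_{iiii}=t_{jjjj}=0$ and $t_{kkkk}=1$, and suppose that an admissible permutation exists. Then $\mathcal{T}$ is positive semi-definite if and only if there is an admissible permutation $(i,j,k)$ such that $t_{iiij}=t_{iiik}=t_{ijjj}=t_{jjjk}=0$ and one of the following conditions is satisfied. (a) $t_{ikkk}=t_{jkkk}=0$, and one of: (a$_1$) $t_{1123}=t_{1223}=t_{1233}=t_{iijj}=t_{jjkk}=t_{iikk}=1$; (a$_2$) $t_{1123}=t_{1223}=t_{1233}=0$ and $t_{iijj},t_{jjkk},t_{iikk}\in\{0,1\}$; (a$_3$) two of $t_{iijk},t_{ijjk},t_{ijkk}$ are $-1$ and the other one is $1$, and $t_{iijj}=t_{jjkk}=t_{iikk}=1$; (a$_4$) there is a permutation $(p,q,r)$ of $(1,2,3)$ such that $t_{ppqr}\in\{-1,1\}$, $t_{pqqr}=t_{pqrr}=0$, $t_{ppqq}=t_{pprr}=1$ and $t_{qqrr}\in\{0,1\}$. (b) $t_{jkkk}\in\{-1,1\}$, $t_{ikkk}=0$, and one of: (b$_1$) $t_{1123}=t_{1223}=t_{1233}=0$, $t_{jjkk}=1$ and $t_{iikk},t_{iijj}\in\{0,1\}$; (b$_2$) $t_{iijk}\in\{-1,1\}$, $t_{ijkk}=t_{ijjk}=0$ and $t_{1122}=t_{2233}=t_{1133}=1$. (c) $t_{ikkk},t_{jkkk}\in\{-1,1\}$, $t_{ikkk}t_{jkkk}t_{ijkk}=t_{iikk}=t_{jjkk}=1$,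 $t_{iijk}=t_{ijjk}=0$ and $t_{iijj}\in\{0,1\}$.
   Context: A 4th order 3-dimensional real tensor $\mathcal{T}=(t_{ijkl})_{i,j,k,l\in\{1,2,3\}}$ is symmetric if its entries are invariant under all permutations of the four indices (so, e.g., $t_{ijjk}$ denotes the common value of all entries whose index multiset is $\{i,j,j,k\}$). $\mathcal{E}_{4,3}$ is the set of symmetric 4th order 3-dimensional tensors all of whose entries lie in $\{-1,0,1\}$. For $x\in\mathbb{R}^3$ put $\mathcal{T}x^4=\sum_{i,j,k,l=1}^3 t_{ijkl}x_ix_jx_kx_l$. $\mathcal{T}$ is positive semi-definite if $\mathcal{T}x^4\ge 0$ for all $x\in\mathbb{R}^3$. *)

theory Defs
  imports "HOL-Analysis.Analysis" "HOL-Combinatorics.Permutations"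
begin

text \<open>
  The index type is the three-element numeral type \<open>3\<close>, whose elements are \<open>1\<close>, \<open>2\<close>
  and \<open>3\<close> (with \<open>3 = 0\<close>); it is the same type that indexes the components of
  \<open>real ^ 3\<close>.
\<close>

type_synonym tensor43 = "3 \<Rightarrow> 3 \<Rightarrow> 3 \<Rightarrow> 3 \<Rightarrow> real"

definition symmetric_tensor :: "tensor43 \<Rightarrow> bool" where
  "symmetric_tensor t \<longleftrightarrow>
     (\<forall>(s :: nat \<Rightarrow> 3) \<pi>. \<pi> permutes {1..4} \<longrightarrow>
        t (s (\<pi> 1)) (s (\<pi> 2)) (s (\<pi> 3)) (s (\<pi> 4)) = t (s 1) (s 2) (s 3) (s 4))"

definition E43 :: "tensor43 set" where
  "E43 = {t. symmetric_tensor t \<and> (\<forall>i j k l. t i j k l \<in> {-1, 0, 1})}"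

definition tensor_form :: "tensor43 \<Rightarrow> real ^ 3 \<Rightarrow> real" where
  "tensor_form t x =
     (\<Sum>i\<in>UNIV. \<Sum>j\<in>UNIV. \<Sum>k\<in>UNIV. \<Sum>l\<in>UNIV. t i j k l * x $ i * x $ j * x $ k * x $ l)"

definition positive_semidefinite :: "tensor43 \<Rightarrow> bool" where
  "positive_semidefinite t \<longleftrightarrow> (\<forall>x. tensor_form t x \<ge> 0)"

definition perm123 :: "3 \<Rightarrow> 3 \<Rightarrow> 3 \<Rightarrow> bool" where
  "perm123 i j k \<longleftrightarrow> distinct [i, j, k] \<and> set [i, j, k] = {1, 2, 3}"

definition admissible :: "tensor43 \<Rightarrow> 3 \<Rightarrow> 3 \<Rightarrow> 3 \<Rightarrow> bool" where
  "admissible t i j k \<longleftrightarrow>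
     perm123 i j k \<and> t i i i i = 0 \<and> t j j j j = 0 \<and> t k k k k = 1"

definition cond_a :: "tensor43 \<Rightarrow> 3 \<Rightarrow> 3 \<Rightarrow> 3 \<Rightarrow> bool" where
  "cond_a t i j k \<longleftrightarrow>
     t i k k k = 0 \<and> t j k k k = 0 \<and>
     ((t 1 1 2 3 = 1 \<and> t 1 2 2 3 = 1 \<and> t 1 2 3 3 = 1 \<and>
       t i i j j = 1 \<and> t j j k k = 1 \<and> t i i k k = 1) \<or>
      (t 1 1 2 3 = 0 \<and> t 1 2 2 3 = 0 \<and> t 1 2 3 3 = 0 \<and>
       t i i j j \<in> {0, 1} \<and> t j j k k \<in> {0, 1} \<and> t i i k k \<in> {0, 1}) \<or>
      (((t i i j k = -1 \<and> t i j j k = -1 \<and> t i j k k = 1) \<or>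
        (t i i j k = -1 \<and> t i j j k = 1 \<and> t i j k k = -1) \<or>
        (t i i j k = 1 \<and> t i j j k = -1 \<and> t i j k k = -1)) \<and>
       t i i j j = 1 \<and> t j j k k = 1 \<and> t i i k k = 1) \<or>
      (\<exists>p q r. perm123 p q r \<and>
         t p p q r \<in> {-1, 1} \<and> t p q q r = 0 \<and> t p q r r = 0 \<and>
         t p p q q = 1 \<and> t p p r r = 1 \<and> t q q r r \<in> {0, 1}))"

definition cond_b :: "tensor43 \<Rightarrow> 3 \<Rightarrow> 3 \<Rightarrow> 3 \<Rightarrow> bool" where
  "cond_b t i j k \<longleftrightarrow>
     t j k k k \<in> {-1, 1} \<and> t i k k k = 0 \<and>
     ((t 1 1 2 3 = 0 \<and> t 1 2 2 3 = 0 \<and> t 1 2 3 3 = 0 \<and>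
       t j j k k = 1 \<and> t i i k k \<in> {0, 1} \<and> t i i j j \<in> {0, 1}) \<or>
      (t i i j k \<in> {-1, 1} \<and> t i j k k = 0 \<and> t i j j k = 0 \<and>
       t 1 1 2 2 = 1 \<and> t 2 2 3 3 = 1 \<and> t 1 1 3 3 = 1))"

definition cond_c :: "tensor43 \<Rightarrow> 3 \<Rightarrow> 3 \<Rightarrow> 3 \<Rightarrow> bool" where
  "cond_c t i j k \<longleftrightarrow>
     t i k k k \<in> {-1, 1} \<and> t j k k k \<in> {-1, 1} \<and>
     t i k k k * t j k k k * t i j k k = 1 \<and> t i i k k = 1 \<and> t j j k k = 1 \<and>
     t i i j k = 0 \<and> t i j j k = 0 \<and> t i i j j \<in> {0, 1}"

end

theory Submission
  imports Defs
begin

text \<open>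
  Write \<open>(x, y, z)\<close> for the variables belonging to an admissible \<open>(i, j, k)\<close>. The form has no
  \<open>x\<^sup>4\<close> and no \<open>y\<^sup>4\<close> term, so letting \<open>x\<close> or \<open>y\<close> dominate kills the coefficients cubic in
  them, and then forces each mixed coefficient of \<open>x\<^sup>2 y z\<close>, \<open>x y\<^sup>2 z\<close> to be controlled by the
  squared ones. Since all entries lie in \<open>{-1, 0, 1}\<close>, domination can be taken
  to mean a fixed ratio, and finitely many integer test points exclude every sign pattern outside
  (a)-(c). In each listed pattern the quartic is an explicit sum of squares, for instance
  \<open>z\<^sup>2 ((z + 2 u)\<^sup>2 + 2 u\<^sup>2)\<close> plus a multiple of \<open>x\<^sup>2 y\<^sup>2\<close>, with \<open>u = \<plusminus> x \<plusminus> y\<close>, in case (c).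
\<close>

text \<open>The factors 4, 6 and 12 count equal tensor entries. With \<open>(x, y, z)\<close>
  attached to \<open>(i, j, k)\<close>, the coefficients \<open>a, b\<close> stand for
  \<open>t i k k k, t j k k k\<close>, then \<open>A, B, C\<close> for
  \<open>t i i j j, t j j k k, t i i k k\<close>, and \<open>D, E, G\<close> for
  \<open>t i i j k, t i j j k, t i j k k\<close>.\<close>

definition ternary_quartic ::
    "real \<Rightarrow> real \<Rightarrow> real \<Rightarrow> real \<Rightarrow> real \<Rightarrow> real \<Rightarrow> real \<Rightarrow> real \<Rightarrow> real \<Rightarrow> real \<Rightarrow> real \<Rightarrow> real" where
  "ternary_quartic a b A B C D E G x y z =
     z^4 + 4 * (a * x * z^3 + b * y * z^3) + 6 * (A * x^2 * y^2 + B * y^2 * z^2 + C * x^2 * z^2)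
     + 12 * (D * x^2 * y * z + E * x * y^2 * z + G * x * y * z^2)"

section \<open>Necessary conditions on the coefficients\<close>

lemma cubic_coeffs_eq_zero:
  fixes p q r s a b A B C D E G :: real
  assumes nonneg: "\<And>x y z. 4 * (p * x^3 * y + q * x * y^3 + r * x^3 * z + s * y^3 * z)
      + ternary_quartic a b A B C D E G x y z \<ge> 0"
    and tern: "p \<in> {-1,0,1}" "q \<in> {-1,0,1}" "r \<in> {-1,0,1}" "s \<in> {-1,0,1}"
      "a \<in> {-1,0,1}" "b \<in> {-1,0,1}" "A \<in> {-1,0,1}" "B \<in> {-1,0,1}" "C \<in> {-1,0,1}"
  shows "p = 0 \<and> q = 0 \<and> r = 0 \<and> s = 0"
proof (intro conjI)
  note P = nonneg[unfolded ternary_quartic_def]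
  \<comment> \<open>At ratio 10 the tested cubic term, if present, has size 4000, while the other
    terms total at most 641.\<close>
  show "p = 0" using P[of 10 1 0] P[of 10 "-1" 0] tern(1,2,7) by auto
  show "q = 0" using P[of 1 10 0] P[of "-1" 10 0] tern(1,2,7) by auto
  show "r = 0" using P[of 10 0 1] P[of 10 0 "-1"] tern(3,5,9) by auto
  show "s = 0" using P[of 0 10 1] P[of 0 10 "-1"] tern(4,6,8) by auto
qed

text \<open>Used to normalise nonzero \<open>a\<close> and \<open>b\<close> to 1 by changing the
  signs of the variables.\<close>

lemma ternary_quartic_flip:
  assumes "e^2 = 1" "f^2 = 1"
  shows "ternary_quartic a b A B C D E G (e * x) (f * y) z =
    ternary_quartic (e * a) (f * b) A B C (f * D) (e * E) (e * f * G) x y z"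
  using assms unfolding ternary_quartic_def by (simp add: power_mult_distrib algebra_simps)

lemma ternary_quartic_swap:
  "ternary_quartic a b A B C D E G x y z = ternary_quartic b a A C B E D G y x z"
  unfolding ternary_quartic_def by (simp add: algebra_simps)

lemma ternary_quartic_nonneg_imp_1_1:
  assumes nonneg: "\<And>x y z. ternary_quartic 1 1 A B C D E G x y z \<ge> 0"
    and le: "A \<le> 1" "B \<le> 1" "C \<le> 1"
    and tern: "D \<in> {-1,0,1}" "E \<in> {-1,0,1}" "G \<in> {-1,0,1}"
  shows "G = 1 \<and> D = 0 \<and> E = 0"
  \<comment> \<open>The point (-1,-1,4) leaves only \<open>G = 1\<close> or
    \<open>D = E = -1, G = 0\<close>, and (1,2,1) excludes the latter. For \<open>G = 1\<close> the
    other three points exclude every \<open>(D, E)\<close> except (0,0).\<close>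
  using tern nonneg[of "-1" "-1" 4] nonneg[of 1 "-2" 2] nonneg[of "-1" 1 1]
    nonneg[of "-1" "-1" 1] nonneg[of 1 2 1] le
  unfolding ternary_quartic_def by (elim insertE emptyE) simp_all

lemma ternary_quartic_nonneg_imp_0_1:
  assumes nonneg: "\<And>x y z. ternary_quartic 0 1 A B C D E G x y z \<ge> 0"
    and le: "A \<le> 1" "B \<le> 1" "C \<le> 1"
    and tern: "D \<in> {-1,0,1}" "E \<in> {-1,0,1}" "G \<in> {-1,0,1}"
  shows "E = 0 \<and> G = 0"
  \<comment> \<open>Pairs of points differing in the sign of \<open>x\<close> bound the absolute
    values of \<open>E - 2 * G\<close>, \<open>E + G\<close> and \<open>2 * E - G\<close> in terms
    of \<open>D\<close>. The first two bounds leave, besides \<open>E = G = 0\<close>, only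
    \<open>D = G = 0\<close> with \<open>E\<close> nonzero; the third excludes that.\<close>
  using tern nonneg[of 1 "-2" 4] nonneg[of "-1" "-2" 4] nonneg[of 1 1 1]
    nonneg[of "-1" 1 1] nonneg[of 1 "-2" 1] nonneg[of "-1" "-2" 1] le
  unfolding ternary_quartic_def by (elim insertE emptyE) simp_all

lemma ternary_quartic_nonneg_imp_0_pm1:
  assumes nonneg: "\<And>x y z. ternary_quartic 0 b A B C D E G x y z \<ge> 0"
    and b: "b \<in> {-1,1}"
    and le: "A \<le> 1" "B \<le> 1" "C \<le> 1"
    and tern: "D \<in> {-1,0,1}" "E \<in> {-1,0,1}" "G \<in> {-1,0,1}"
  shows "E = 0 \<and> G = 0"
proof -
  have "b^2 = 1" using b by auto
  then have "ternary_quartic 0 1 A B C (b * D) E (b * G) x y z \<ge> 0" for x y z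
    using nonneg[of x "b * y" z] ternary_quartic_flip[of 1 b 0 b A B C D E G x y z]
    by (simp add: power2_eq_square)
  then have "E = 0 \<and> b * G = 0"
    by (rule ternary_quartic_nonneg_imp_0_1) (use le tern b in auto)
  then show ?thesis using b by auto
qed

lemma ternary_bounds:
  fixes u :: real
  assumes "u \<in> {-1,0,1}"
  shows "- 1 \<le> u" "u \<le> 1"
  using assms by auto

lemma ternary_quartic_nonneg_imp:
  fixes a b A B C D E G :: real
  assumes nonneg: "\<And>x y z. ternary_quartic a b A B C D E G x y z \<ge> 0"
    and tern: "a \<in> {-1,0,1}" "b \<in> {-1,0,1}" "A \<in> {-1,0,1}" "B \<in> {-1,0,1}" "C \<in> {-1,0,1}"
      "D \<in> {-1,0,1}" "E \<in> {-1,0,1}" "G \<in> {-1,0,1}"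
  shows "A \<in> {0,1}" "B \<in> {0,1}" "C \<in> {0,1}"
    and "a \<noteq> 0 \<Longrightarrow> C = 1" "b \<noteq> 0 \<Longrightarrow> B = 1"
    and "D \<noteq> 0 \<Longrightarrow> A = 1 \<and> C = 1" "E \<noteq> 0 \<Longrightarrow> A = 1 \<and> B = 1"
    and "G \<noteq> 0 \<Longrightarrow> B = 1 \<and> C = 1"
    and "a \<noteq> 0 \<Longrightarrow> b \<noteq> 0 \<Longrightarrow> a * b * G = 1 \<and> D = 0 \<and> E = 0"
    and "a = 0 \<Longrightarrow> b \<noteq> 0 \<Longrightarrow> E = 0 \<and> G = 0"
    and "a \<noteq> 0 \<Longrightarrow> b = 0 \<Longrightarrow> D = 0 \<and> G = 0"
    and "a = 0 \<Longrightarrow> b = 0 \<Longrightarrow>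
      (E = 0 \<and> G = 0) \<or> (D = 0 \<and> G = 0) \<or> (D = 0 \<and> E = 0) \<or> D * E * G = 1"
proof -
  note P = nonneg and [simp] = ternary_quartic_def
  show A: "A \<in> {0,1}" using P[of 1 1 0] tern(3) by auto
  show B: "B \<in> {0,1}" using P[of 0 1 1] P[of 0 "-1" 1] tern(2,4) by auto
  show C: "C \<in> {0,1}" using P[of 1 0 1] P[of "-1" 0 1] tern(1,5) by auto
  show aC: "C = 1" if "a \<noteq> 0" using P[of 1 0 1] P[of "-1" 0 1] tern(1,5) that by auto
  show bB: "B = 1" if "b \<noteq> 0" using P[of 0 1 1] P[of 0 "-1" 1] tern(2,4) that by auto
  have bds: "A \<le> 1" "B \<le> 1" "C \<le> 1"
      "- 1 \<le> a" "a \<le> 1" "- 1 \<le> b" "b \<le> 1" "- 1 \<le> D" "D \<le> 1" 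
      "- 1 \<le> E" "E \<le> 1" "- 1 \<le> G" "G \<le> 1"
    using tern[THEN ternary_bounds(1)] tern[THEN ternary_bounds(2)] by simp_all
  show D: "A = 1 \<and> C = 1" if "D \<noteq> 0"
  proof -
    \<comment> \<open>The form is 600 times the left-hand side plus terms of total at most
      291.\<close>
    have "A + C + 2 * D > - 1" "A + C - 2 * D > - 1"
      using P[of 10 1 1] P[of 10 "-1" 1] bds by simp_all
    then show ?thesis using A C tern(6) that by auto
  qed
  show E: "A = 1 \<and> B = 1" if "E \<noteq> 0"
  proof -
    have "A + B + 2 * E > - 1" "A + B - 2 * E > - 1"
      using P[of 1 10 1] P[of "-1" 10 1] bds by simp_all
    then show ?thesis using A B tern(7) that by auto
  qed
  show "B = 1 \<and> C = 1" if "G \<noteq> 0"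
  proof
    show "B = 1"
    proof (rule ccontr)
      assume "B \<noteq> 1"
      with B bB E have "B = 0" "b = 0" "E = 0" by auto
      \<comment> \<open>With \<open>b = B = E = 0\<close> the \<open>G\<close> term has size 1152 at
        these points and the others total at most 256 + 256 + 312 + 288 = 1112, so a choice of signs
        making it negative contradicts nonnegativity.\<close>
      then show False
        using P[of 1 6 4] P[of "-1" 6 4] P[of 1 "-6" 4] P[of "-1" "-6" 4]
          that tern(1,6,8) bds(1,3)
        by (elim insertE emptyE) simp_all
    qed
    show "C = 1"
    proof (rule ccontr)
      assume "C \<noteq> 1"
      with C aC D have "C = 0" "a = 0" "D = 0" by auto
      then show False
        using P[of 6 1 4] P[of "-6" 1 4] P[of 6 "-1" 4] P[of "-6" "-1" 4]
          that tern(2,7,8) bds(1,2)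
        by (elim insertE emptyE) simp_all
    qed
  qed
  show "a * b * G = 1 \<and> D = 0 \<and> E = 0" if "a \<noteq> 0" "b \<noteq> 0"
  proof -
    have ab: "a \<in> {-1,1}" "b \<in> {-1,1}" using tern(1,2) that by auto
    then have "a^2 = 1" "b^2 = 1" by auto
    then have "ternary_quartic 1 1 A B C (b * D) (a * E) (a * b * G) x y z \<ge> 0" for x y z
      using nonneg[of "a * x" "b * y" z] ternary_quartic_flip[of a b a b A B C D E G x y z]
      by (simp add: power2_eq_square del: ternary_quartic_def)
    then have "a * b * G = 1 \<and> b * D = 0 \<and> a * E = 0"
      by (rule ternary_quartic_nonneg_imp_1_1) (use bds(1-3) tern(6-8) ab in auto)
    then show ?thesis using that by simp
  qed
  show "E = 0 \<and> G = 0" if "a = 0" "b \<noteq> 0"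
  proof (rule ternary_quartic_nonneg_imp_0_pm1)
    show "ternary_quartic 0 b A B C D E G x y z \<ge> 0" for x y z
      using nonneg[of x y z] \<open>a = 0\<close> by (simp only:)
  qed (use tern bds(1-3) that in blast)+
  show "D = 0 \<and> G = 0" if "a \<noteq> 0" "b = 0"
  proof (rule ternary_quartic_nonneg_imp_0_pm1)
    show "ternary_quartic 0 a A C B E D G x y z \<ge> 0" for x y z
      using nonneg[of y x z] ternary_quartic_swap[of a b A B C D E G y x z] \<open>b = 0\<close> by (simp only:)
  qed (use tern bds(1-3) that in blast)+
  show "(E = 0 \<and> G = 0) \<or> (D = 0 \<and> G = 0) \<or> (D = 0 \<and> E = 0) \<or> D * E * G = 1" if "a = 0" "b = 0"
    \<comment> \<open>The values are at most \<open>19 + 12 * (d * D + e * E + g * G)\<close> with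
      signs satisfying \<open>d * e * g = 1\<close>. If exactly two unknowns are nonzero, or all
      three with product -1, some choice makes every nonzero summand -1, a contradiction.\<close>
    using tern(6-8) P[of 1 1 1] P[of "-1" 1 1] P[of 1 "-1" 1] P[of "-1" "-1" 1] that bds(1-3)
    by (elim insertE emptyE) simp_all
qed

section \<open>Tensor symmetry and the form in coordinates\<close>

text \<open>Adjacent transpositions generate all permutations of the positions; as permutative
  rewrite rules these equations sort index words.\<close>

lemma symmetric_tensor_swaps:
  assumes "symmetric_tensor t"
  shows "t i j k l = t j i k l" "t i j k l = t i k j l" "t i j k l = t i j l k"
proof -
  define s :: "nat \<Rightarrow> 3" where "s n = (if n = 1 then i else if n = 2 then j else if n = 3 then k else l)" for n
  have *: "t (s (\<pi> 1)) (s (\<pi> 2)) (s (\<pi> 3)) (s (\<pi> 4)) = t (s 1) (s 2) (s 3) (s 4)"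
    if "\<pi> permutes {1..4}" for \<pi>
    using assms that unfolding symmetric_tensor_def by blast
  have "Transposition.transpose m n permutes {1..4::nat}" if "m \<in> {1..4}" "n \<in> {1..4}" for m n
    using that by (rule permutes_swap_id)
  from *[OF this[of 1 2]] *[OF this[of 2 3]] *[OF this[of 3 4]]
  show "t i j k l = t j i k l" "t i j k l = t i k j l" "t i j k l = t i j l k"
    by (simp_all add: s_def transpose_def)
qed

lemma perm123_UNIV:
  assumes "perm123 i j k"
  shows "UNIV = {i, j, k}" "i \<noteq> j" "i \<noteq> k" "j \<noteq> k"
  using assms UNIV_3 unfolding perm123_def by auto

lemma perm123_cases:
  assumes "perm123 i j k" "perm123 p q r"
  shows "(p, q, r) \<in> {(i,j,k), (i,k,j), (j,i,k), (j,k,i), (k,i,j), (k,j,i)}"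
proof -
  note ijk = perm123_UNIV[OF assms(1)] and pqr = perm123_UNIV[OF assms(2)]
  have "p \<in> {i,j,k}" "q \<in> {i,j,k}" "r \<in> {i,j,k}"
    using ijk(1) by auto
  then show ?thesis
    using pqr(2-4) by (elim insertE emptyE) simp_all
qed

text \<open>\<open>ternary_quartic\<close> fixes the coefficient of \<open>z^4\<close> at 1, hence
  the correction \<open>t k k k k - 1\<close>, which vanishes for an admissible triple.\<close>

lemma tensor_form_eq:
  assumes sym: "symmetric_tensor t" and perm: "perm123 i j k"
  shows "tensor_form t v = t i i i i * (v $ i)^4 + t j j j j * (v $ j)^4 + (t k k k k - 1) * (v $ k)^4
     + 4 * (t i i i j * (v $ i)^3 * v $ j + t i j j j * v $ i * (v $ j)^3
            + t i i i k * (v $ i)^3 * v $ k + t j j j k * (v $ j)^3 * v $ k)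
     + ternary_quartic (t i k k k) (t j k k k) (t i i j j) (t j j k k) (t i i k k)
         (t i i j k) (t i j j k) (t i j k k) (v $ i) (v $ j) (v $ k)"
  unfolding tensor_form_def ternary_quartic_def perm123_UNIV(1)[OF perm]
  using perm123_UNIV(2-4)[OF perm]
  by (simp add: symmetric_tensor_swaps[OF sym])
    (simp add: algebra_simps power4_eq_xxxx power3_eq_cube power2_eq_square)

section \<open>Sums of squares for the listed patterns\<close>

lemma ternary_quartic_nonneg_squares:
  assumes "A \<ge> 0" "B \<ge> 0" "C \<ge> 0"
  shows "ternary_quartic 0 0 A B C 0 0 0 x y z \<ge> 0"
  using assms unfolding ternary_quartic_def by simp

text \<open>Since \<open>G = D * E\<close>, all terms besides \<open>z^4\<close> form six times one
  square. Both (a1) and (a3) have this shape.\<close>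

lemma ternary_quartic_nonneg_product:
  assumes "D \<in> {-1,1}" "E \<in> {-1,1}" "D * E * G = 1"
  shows "ternary_quartic 0 0 1 1 1 D E G x y z \<ge> 0"
proof -
  have "D^2 = 1" "E^2 = 1" "G = D * E"
    using assms by auto
  then have "ternary_quartic 0 0 1 1 1 D E G x y z = z^4 + 6 * (x * y + E * y * z + D * x * z)^2"
    unfolding ternary_quartic_def
    by (simp add: power2_sum power_mult_distrib) (simp add: algebra_simps power2_eq_square)
  then show ?thesis by simp
qed

lemma ternary_quartic_nonneg_linear_one:
  assumes "B \<ge> 0" "D \<in> {-1,1}"
  shows "ternary_quartic 0 0 1 B 1 D 0 0 x y z \<ge> 0"
proof -
  have "D^2 = 1" using assms by auto
  then have "ternary_quartic 0 0 1 B 1 D 0 0 x y z = z^4 + 6 * (x * (y + D * z))^2 + 6 * B * (y * z)^2"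
    unfolding ternary_quartic_def
    by (simp add: power2_sum power_mult_distrib) (simp add: algebra_simps power2_eq_square)
  then show ?thesis using assms(1) by simp
qed

lemma ternary_quartic_nonneg_linear_last:
  assumes "A \<ge> 0" "G \<in> {-1,1}"
  shows "ternary_quartic 0 0 A 1 1 0 0 G x y z \<ge> 0"
proof -
  have "G^2 = 1" using assms by auto
  then have "ternary_quartic 0 0 A 1 1 0 0 G x y z = z^4 + 6 * (z * (x + G * y))^2 + 6 * A * (x * y)^2"
    unfolding ternary_quartic_def
    by (simp add: power2_sum power_mult_distrib) (simp add: algebra_simps power2_eq_square)
  then show ?thesis using assms(1) by simp
qed

text \<open>The terms free of \<open>x\<close> are nonnegative on their own; the rest is
  \<open>x^2\<close> times a quadratic form in \<open>y, z\<close>, and the alternatives for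
  \<open>D\<close> make that form nonnegative.\<close>

lemma ternary_quartic_nonneg_cubic_one:
  assumes "b \<in> {-1,1}" and "D = 0 \<and> A \<ge> 0 \<and> C \<ge> 0 \<or> D \<in> {-1,1} \<and> A = 1 \<and> C = 1"
  shows "ternary_quartic 0 b A 1 C D 0 0 x y z \<ge> 0"
proof -
  have "b^2 = 1" using assms(1) by auto
  then have eq: "ternary_quartic 0 b A 1 C D 0 0 x y z =
      z^2 * ((z + 2 * b * y)^2 + 2 * y^2) + 6 * x^2 * (A * y^2 + 2 * D * y * z + C * z^2)"
    unfolding ternary_quartic_def
    by (simp add: power2_sum power_mult_distrib)
      (simp add: algebra_simps power2_eq_square power3_eq_cube power4_eq_xxxx)
  have "A * y^2 + 2 * D * y * z + C * z^2 \<ge> 0"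
    using assms(2)
  proof
    assume *: "D \<in> {-1,1} \<and> A = 1 \<and> C = 1"
    then have "A * y^2 + 2 * D * y * z + C * z^2 = (y + D * z)^2"
      by (auto simp: power2_sum power2_diff)
    then show ?thesis by simp
  qed simp
  then show ?thesis unfolding eq by simp
qed

text \<open>With \<open>u = a * x + b * y\<close>, the relation \<open>G = a * b\<close> turns all
  terms but the \<open>A\<close> term into \<open>z^4 + 4 * u * z^3 + 6 * u^2 * z^2\<close>.\<close>

lemma ternary_quartic_nonneg_cubic_two:
  assumes "a \<in> {-1,1}" "b \<in> {-1,1}" "a * b * G = 1" "A \<ge> 0"
  shows "ternary_quartic a b A 1 1 0 0 G x y z \<ge> 0"
proof -
  have "a^2 = 1" "b^2 = 1" "G = a * b"
    using assms(1-3) by auto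
  then have "ternary_quartic a b A 1 1 0 0 G x y z =
      z^2 * ((z + 2 * (a * x + b * y))^2 + 2 * (a * x + b * y)^2) + 6 * A * (x * y)^2"
    unfolding ternary_quartic_def
    by (simp add: power2_sum power_mult_distrib)
      (simp add: algebra_simps power2_eq_square power3_eq_cube power4_eq_xxxx)
  then show ?thesis using assms(4) by simp
qed

section \<open>The conditions relative to a triple\<close>

text \<open>Relabelling only permutes each group of three entries, so their having the common value
  \<open>c\<close> is unaffected.\<close>

lemma mixed_entries_iff:
  assumes sym: "symmetric_tensor t" and perm: "perm123 i j k"
  shows "t 1 1 2 3 = c \<and> t 1 2 2 3 = c \<and> t 1 2 3 3 = c \<longleftrightarrow>
      t i i j k = c \<and> t i j j k = c \<and> t i j k k = c"
    and "t 1 1 2 2 = c \<and> t 2 2 3 3 = c \<and> t 1 1 3 3 = c \<longleftrightarrow>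
      t i i j j = c \<and> t j j k k = c \<and> t i i k k = c"
proof -
  have "perm123 1 2 3" unfolding perm123_def by simp
  from perm123_cases[OF this perm]
  show "t 1 1 2 3 = c \<and> t 1 2 2 3 = c \<and> t 1 2 3 3 = c \<longleftrightarrow>
      t i i j k = c \<and> t i j j k = c \<and> t i j k k = c"
    and "t 1 1 2 2 = c \<and> t 2 2 3 3 = c \<and> t 1 1 3 3 = c \<longleftrightarrow>
      t i i j j = c \<and> t j j k k = c \<and> t i i k k = c"
    by (auto simp: symmetric_tensor_swaps[OF sym])
qed

lemma cond_a_iff:
  assumes sym: "symmetric_tensor t" and perm: "perm123 i j k"
  shows "cond_a t i j k \<longleftrightarrow> t i k k k = 0 \<and> t j k k k = 0 \<and>
     (t i i j k = 1 \<and> t i j j k = 1 \<and> t i j k k = 1 \<and>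
        t i i j j = 1 \<and> t j j k k = 1 \<and> t i i k k = 1 \<or>
      t i i j k = 0 \<and> t i j j k = 0 \<and> t i j k k = 0 \<and>
        t i i j j \<in> {0,1} \<and> t j j k k \<in> {0,1} \<and> t i i k k \<in> {0,1} \<or>
      (t i i j k = -1 \<and> t i j j k = -1 \<and> t i j k k = 1 \<or>
       t i i j k = -1 \<and> t i j j k = 1 \<and> t i j k k = -1 \<or>
       t i i j k = 1 \<and> t i j j k = -1 \<and> t i j k k = -1) \<and>
        t i i j j = 1 \<and> t j j k k = 1 \<and> t i i k k = 1 \<or>
      t i i j k \<in> {-1,1} \<and> t i j j k = 0 \<and> t i j k k = 0 \<and>
        t i i j j = 1 \<and> t i i k k = 1 \<and> t j j k k \<in> {0,1} \<or>
      t i i j k = 0 \<and> t i j j k \<in> {-1,1} \<and> t i j k k = 0 \<and>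
        t i i j j = 1 \<and> t j j k k = 1 \<and> t i i k k \<in> {0,1} \<or>
      t i i j k = 0 \<and> t i j j k = 0 \<and> t i j k k \<in> {-1,1} \<and>
        t i i k k = 1 \<and> t j j k k = 1 \<and> t i i j j \<in> {0,1})"
proof -
  define a4 where "a4 p q r \<longleftrightarrow> t p p q r \<in> {-1, 1} \<and> t p q q r = 0 \<and> t p q r r = 0 \<and>
      t p p q q = 1 \<and> t p p r r = 1 \<and> t q q r r \<in> {0, 1}" for p q r
  \<comment> \<open>By this symmetry (a4) depends only on the choice of \<open>p\<close>, leaving
    three cases.\<close>
  have flip: "a4 p r q \<longleftrightarrow> a4 p q r" for p q r
    unfolding a4_def by (auto simp: symmetric_tensor_swaps[OF sym])
  have perms: "perm123 j i k" "perm123 k i j"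
    using perm unfolding perm123_def by auto
  have ex: "(\<exists>p q r. perm123 p q r \<and> a4 p q r) \<longleftrightarrow> a4 i j k \<or> a4 j i k \<or> a4 k i j"
    (is "?L \<longleftrightarrow> ?R")
  proof
    assume ?L
    then obtain p q r where "perm123 p q r" "a4 p q r" by blast
    then show ?R
      using perm123_cases[OF perm, of p q r] by (auto simp: flip[of i j k] flip[of j i k] flip[of k i j])
  qed (use perm perms in blast)
  have a4: "a4 i j k \<longleftrightarrow> t i i j k \<in> {-1,1} \<and> t i j j k = 0 \<and> t i j k k = 0 \<and>
        t i i j j = 1 \<and> t i i k k = 1 \<and> t j j k k \<in> {0,1}"
    "a4 j i k \<longleftrightarrow> t i i j k = 0 \<and> t i j j k \<in> {-1,1} \<and> t i j k k = 0 \<and>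
        t i i j j = 1 \<and> t j j k k = 1 \<and> t i i k k \<in> {0,1}"
    "a4 k i j \<longleftrightarrow> t i i j k = 0 \<and> t i j j k = 0 \<and> t i j k k \<in> {-1,1} \<and>
        t i i k k = 1 \<and> t j j k k = 1 \<and> t i i j j \<in> {0,1}"
    unfolding a4_def by (auto simp: symmetric_tensor_swaps[OF sym])
  \<comment> \<open>In \<open>cond_a\<close> the triple is followed by further conjuncts, so the
    equivalence is needed in this extended shape.\<close>
  have triple: "(P \<and> Q \<and> R \<and> X \<longleftrightarrow> P' \<and> Q' \<and> R' \<and> X)"
    if "P \<and> Q \<and> R \<longleftrightarrow> P' \<and> Q' \<and> R'" for P Q R P' Q' R' X
    using that by blast
  show ?thesis
    unfolding cond_a_def triple[OF mixed_entries_iff(1)[OF sym perm]]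
    unfolding a4_def[symmetric] ex
    unfolding a4 ..
qed

lemma cond_b_iff:
  assumes sym: "symmetric_tensor t" and perm: "perm123 i j k"
  shows "cond_b t i j k \<longleftrightarrow> t j k k k \<in> {-1,1} \<and> t i k k k = 0 \<and>
     t j j k k = 1 \<and> t i j j k = 0 \<and> t i j k k = 0 \<and>
     (t i i j k = 0 \<and> t i i k k \<in> {0,1} \<and> t i i j j \<in> {0,1} \<or>
      t i i j k \<in> {-1,1} \<and> t i i k k = 1 \<and> t i i j j = 1)"
  unfolding cond_b_def
  using mixed_entries_iff(1)[OF sym perm, of 0] mixed_entries_iff(2)[OF sym perm, of 1]
  by auto

lemma conditions_imp_ternary_quartic_nonneg:
  assumes sym: "symmetric_tensor t" and perm: "perm123 i j k"
    and cond: "cond_a t i j k \<or> cond_b t i j k \<or> cond_c t i j k"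
  shows "ternary_quartic (t i k k k) (t j k k k) (t i i j j) (t j j k k) (t i i k k)
         (t i i j k) (t i j j k) (t i j k k) x y z \<ge> 0"
  using cond
proof (elim disjE)
  assume "cond_a t i j k"
  then show ?thesis
    unfolding cond_a_iff[OF sym perm]
  \<comment> \<open>Case 1 is (a1), 2 is (a2), 3 to 5 are (a3), and 6 to 8 are (a4) with
    \<open>p\<close> equal to \<open>i\<close>, \<open>j\<close>, \<open>k\<close>.\<close>
  proof (elim conjE disjE, goal_cases)
    case 2
    then show ?thesis using ternary_quartic_nonneg_squares by auto
  next
    case 6
    then show ?thesis using ternary_quartic_nonneg_linear_one[of "t j j k k" "t i i j k" x y z] by auto
  next
    case 7
    then show ?thesis
      using ternary_quartic_nonneg_linear_one[of "t i i k k" "t i j j k" y x z]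
        ternary_quartic_swap[of 0 0 1 "t i i k k" 1 "t i j j k" 0 0 y x z] by auto
  next
    case 8
    then show ?thesis using ternary_quartic_nonneg_linear_last[of "t i i j j" "t i j k k" x y z] by auto
  qed (use ternary_quartic_nonneg_product[of "t i i j k" "t i j j k" "t i j k k" x y z] in simp)+
next
  assume "cond_b t i j k"
  then show ?thesis
    unfolding cond_b_iff[OF sym perm]
    using ternary_quartic_nonneg_cubic_one[of "t j k k k" "t i i j k" "t i i j j" "t i i k k" x y z]
    by auto
next
  assume "cond_c t i j k"
  then show ?thesis
    unfolding cond_c_def
    using ternary_quartic_nonneg_cubic_two[of "t i k k k" "t j k k k" "t i j k k" "t i i j j" x y z]
    by auto
qed

section \<open>The equivalence for tensors\<close>

text \<open>Which of \<open>t i k k k\<close> and \<open>t j k k k\<close> vanish selects the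
  condition. As (b) wants the nonzero one to be \<open>t j k k k\<close>, the opposite case needs
  \<open>i\<close> and \<open>j\<close> interchanged.\<close>

lemma admissible_nonneg_imp_conditions:
  assumes t: "t \<in> E43" and adm: "admissible t i j k" and psd: "positive_semidefinite t"
  shows "t i i i j = 0 \<and> t i j j j = 0 \<and> t i i i k = 0 \<and> t j j j k = 0 \<and>
    (cond_a t i j k \<or> cond_b t i j k \<or> cond_b t j i k \<or> cond_c t i j k)"
proof -
  have sym: "symmetric_tensor t" and entries: "t p q r s \<in> {-1,0,1}" for p q r s
    using t unfolding E43_def by blast+
  have perm: "perm123 i j k" and diag: "t i i i i = 0" "t j j j j = 0" "t k k k k = 1"
    using adm unfolding admissible_def by auto
  then have perm': "perm123 j i k" unfolding perm123_def by auto
  note ne = perm123_UNIV(2-4)[OF perm]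
  have nonneg: "4 * (t i i i j * x^3 * y + t i j j j * x * y^3 + t i i i k * x^3 * z + t j j j k * y^3 * z)
      + ternary_quartic (t i k k k) (t j k k k) (t i i j j) (t j j k k) (t i i k k)
         (t i i j k) (t i j j k) (t i j k k) x y z \<ge> 0" for x y z
  proof -
    define v :: "real^3" where "v = (\<chi> m. if m = i then x else if m = j then y else z)"
    have "v $ i = x" "v $ j = y" "v $ k = z" using ne by (auto simp: v_def)
    moreover have "tensor_form t v \<ge> 0"
      using psd unfolding positive_semidefinite_def by blast
    ultimately show ?thesis
      unfolding tensor_form_eq[OF sym perm] diag by simp
  qed
  have cubic: "t i i i j = 0 \<and> t i j j j = 0 \<and> t i i i k = 0 \<and> t j j j k = 0"
    by (rule cubic_coeffs_eq_zero[OF nonneg]) (rule entries)+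
  then have "ternary_quartic (t i k k k) (t j k k k) (t i i j j) (t j j k k) (t i i k k)
         (t i i j k) (t i j j k) (t i j k k) x y z \<ge> 0" for x y z
    using nonneg[of x y z] by simp
  note N = ternary_quartic_nonneg_imp[OF this entries entries entries entries entries entries entries entries]
  have b_swap: "cond_b t j i k \<longleftrightarrow> t i k k k \<in> {-1,1} \<and> t j k k k = 0 \<and>
     t i i k k = 1 \<and> t i i j k = 0 \<and> t i j k k = 0 \<and>
     (t i j j k = 0 \<and> t j j k k \<in> {0,1} \<and> t i i j j \<in> {0,1} \<or>
      t i j j k \<in> {-1,1} \<and> t j j k k = 1 \<and> t i i j j = 1)"
    unfolding cond_b_iff[OF sym perm'] by (simp add: symmetric_tensor_swaps[OF sym])
  consider "t i k k k = 0" "t j k k k = 0" | "t i k k k = 0" "t j k k k \<noteq> 0"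
    | "t i k k k \<noteq> 0" "t j k k k = 0" | "t i k k k \<noteq> 0" "t j k k k \<noteq> 0" by blast
  then have "cond_a t i j k \<or> cond_b t i j k \<or> cond_b t j i k \<or> cond_c t i j k"
  proof cases
    case 1
    have "cond_a t i j k"
      unfolding cond_a_iff[OF sym perm]
      using entries[of i i j k] entries[of i j j k] entries[of i j k k] N(1-3,6-8) N(12)[OF 1] 1
      by (elim insertE emptyE) simp_all
    then show ?thesis by blast
  next
    case 2
    have "cond_b t i j k"
      unfolding cond_b_iff[OF sym perm]
      using 2 N(1-3,5,6) N(10)[OF 2] entries[of j k k k] entries[of i i j k] by auto
    then show ?thesis by blast
  next
    case 3
    have "cond_b t j i k"
      unfolding b_swap
      using 3 N(1-3,4,7) N(11)[OF 3] entries[of i k k k] entries[of i j j k] by auto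
    then show ?thesis by blast
  next
    case 4
    have "cond_c t i j k"
      unfolding cond_c_def
      using 4 N(1,4,5) N(9)[OF 4] entries[of i k k k] entries[of j k k k] by auto
    then show ?thesis by blast
  qed
  with cubic show ?thesis by blast
qed

theorem corollary3p5:
  fixes t :: tensor43
  assumes "t \<in> E43"
    and "\<exists>i j k. admissible t i j k"
  shows "positive_semidefinite t \<longleftrightarrow>
    (\<exists>i j k. admissible t i j k \<and>
       t i i i j = 0 \<and> t i i i k = 0 \<and> t i j j j = 0 \<and> t j j j k = 0 \<and>
       (cond_a t i j k \<or> cond_b t i j k \<or> cond_c t i j k))"
proof
  have sym: "symmetric_tensor t" using assms(1) unfolding E43_def by blast
  {
    assume psd: "positive_semidefinite t"
    obtain i j k where adm: "admissible t i j k" using assms(2) by blast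
    note H = admissible_nonneg_imp_conditions[OF assms(1) adm psd]
    \<comment> \<open>Admissibility singles out only \<open>k\<close>, so \<open>(j, i, k)\<close>
      is the witness when \<open>cond_b t j i k\<close> holds.\<close>
    have "admissible t j i k" using adm unfolding admissible_def perm123_def by auto
    moreover have "t j j j i = t i j j j" "t j i i i = t i i i j"
      by (simp_all add: symmetric_tensor_swaps[OF sym])
    ultimately show "\<exists>i j k. admissible t i j k \<and>
       t i i i j = 0 \<and> t i i i k = 0 \<and> t i j j j = 0 \<and> t j j j k = 0 \<and>
       (cond_a t i j k \<or> cond_b t i j k \<or> cond_c t i j k)"
      using H adm by metis
  next
    assume "\<exists>i j k. admissible t i j k \<and>
       t i i i j = 0 \<and> t i i i k = 0 \<and> t i j j j = 0 \<and> t j j j k = 0 \<and>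
       (cond_a t i j k \<or> cond_b t i j k \<or> cond_c t i j k)"
    then obtain i j k where adm: "admissible t i j k"
      and cubic: "t i i i j = 0" "t i i i k = 0" "t i j j j = 0" "t j j j k = 0"
      and cond: "cond_a t i j k \<or> cond_b t i j k \<or> cond_c t i j k" by blast
    then have perm: "perm123 i j k" and diag: "t i i i i = 0" "t j j j j = 0" "t k k k k = 1"
      unfolding admissible_def by auto
    show "positive_semidefinite t"
      unfolding positive_semidefinite_def tensor_form_eq[OF sym perm] diag cubic
      using conditions_imp_ternary_quartic_nonneg[OF sym perm cond] by simp
  }
qed

end
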